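(* Let $E$ be a compact metric space, $X=E^{\mathbb{N}}$, let $p$ be a Borel probability measure on $E$ with full support, let $f:X\to\mathbb{R}$ be a continuous potential, and let $\nu\in\mathscr{G}^{*}(f)$. Let $\xi_{f}\in L^1(\nu)^{**}$ be an eigenvector of $\mathbb{L}_{f}^{**}$, $\mathbb{L}_{f}^{**}\xi_f=\rho(\mathscr{L}_f)\xi_f$, which is the weak-$*$ limit of some convergent subnet of the sequence $$\xi_n=\rho(\mathscr{L}_f)^{-n}J(\mathbb{L}_f^n(1)),\qquad n\in\mathbb{N},$$ where $J:L^1(\nu)\to L^1(\nu)^{**}$ is the canonical map. Then the set function $\mu$ on $\mathscr{B}(X)$ given by $$\mathscr{B}(X)\ni A\mapsto\mu(A)=\xi_{f}(1_{A}\nu)$$ is non-negative, finitely additive and shift-invariant, i.e. $\mu(\sigma^{-1}(A))=\mu(A)$ for every $A\in\mathscr{B}(X)$.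
   Context: $X=E^{\mathbb{N}}$ carries the product topology (which is compact metrizable) and its Borel $\sigma$-algebra $\mathscr{B}(X)$; $\sigma:X\to X$ is the left shift; $C(X)$ is the Banach space of real continuous functions on $X$ with the sup norm. For $a\in E$ and $x=(x_1,x_2,\ldots)\in X$, $ax=(a,x_1,x_2,\ldots)$. The a priori measure $p$ is a fixed Borel probability measure on $E$ with $\mathrm{supp}(p)=E$. The Ruelle operator $\mathscr{L}_f:C(X)\to C(X)$ is $\mathscr{L}_{f}\varphi(x)=\int_{E}\exp(f(ax))\varphi(ax)\,dp(a)$, and $\rho(\mathscr{L}_f)$ is its spectral radius on $(C(X),\|\cdot\|_\infty)$. Let $\mathscr{M}_s(X)\cong C(X)^*$ be the space of finite signed Borel measures on $X$ and $\mathscr{M}_1(X)$ the set of Borel probability measures on $X$. The transpose $\mathscr{L}_f^*$ acts on $\mathscr{M}_s(X)$ by $\int_X\varphi\,d[\mathscr{L}_f^*\mu]=\int_X\mathscr{L}_f\varphi\,d\mu$ for all $\varphi\in C(X)$. Define $\mathscr{G}^{*}(f)=\{\nu\in\mathscr{M}_1(X):\mathscr{L}_{f}^{*}\nu=\rho(\mathscr{L}_{f})\nu\}$. Since $p$ has full support, every $\nu\in\mathscr{G}^*(f)$ has full support, so $C(X)$ embeds in $L^1(\nu)=L^1(X,\mathscr{B}(X),\nu)$; $\mathbb{L}_f:L^1(\nu)\to L^1(\nu)$ denotes the bounded positive linear operator extending $\mathscr{L}_f$, i.e. $\mathbb{L}_f[\varphi]_\nu=[\mathscr{L}_f\varphi]_\nu$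 for all $\varphi\in C(X)$ (it exists, and is unique by density of $C(X)$). Its transpose is $\mathbb{L}_f^*:L^1(\nu)^*\to L^1(\nu)^*$, $\mathbb{L}_f^*\ell=\ell\circ\mathbb{L}_f$, and its double transpose $\mathbb{L}_f^{**}:L^1(\nu)^{**}\to L^1(\nu)^{**}$ is $(\mathbb{L}_f^{**}\xi)(\ell)=\xi(\mathbb{L}_f^*\ell)$. The canonical map is $J(\varphi)(\ell)=\ell(\varphi)$. The weak-$*$ topology on $L^1(\nu)^{**}$ is that of pointwise convergence on $L^1(\nu)^*$. For $A\in\mathscr{B}(X)$, $1_A\nu$ denotes the element of $L^1(\nu)^*$ given by $\varphi\mapsto\int_X 1_A\varphi\,d\nu$. *)

theory Defs
  imports "HOL-Probability.Probability"
begin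

section \<open>Spectral radius\<close>

text \<open>
  The scalars are real, so the spectrum of a bounded operator \<open>T\<close> is that of its
  complexification. The pair \<open>(u, v)\<close> stands for \<open>u + \<i>v\<close>, and \<open>cplx_resolvent_map T z\<close> is
  \<open>z - T\<close> on such pairs. A real-linear two-sided inverse of this complex-linear map is
  automatically complex-linear.
\<close>

definition cplx_resolvent_map ::
  "('v::real_normed_vector \<Rightarrow> 'v) \<Rightarrow> complex \<Rightarrow> 'v \<times> 'v \<Rightarrow> 'v \<times> 'v" where
  "cplx_resolvent_map T z = (\<lambda>(u, v).
     (Re z *\<^sub>R u - Im z *\<^sub>R v - T u, Im z *\<^sub>R u + Re z *\<^sub>R v - T v))"

definition op_spectrum :: "('v::real_normed_vector \<Rightarrow> 'v) \<Rightarrow> complex set" where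
  "op_spectrum T = {z. \<not> (\<exists>S. bounded_linear S \<and>
     S \<circ> cplx_resolvent_map T z = id \<and> cplx_resolvent_map T z \<circ> S = id)}"

definition op_spectral_radius :: "('v::real_normed_vector \<Rightarrow> 'v) \<Rightarrow> real" where
  "op_spectral_radius T = (SUP z\<in>op_spectrum T. cmod z)"

section \<open>Normed spaces on explicit carriers, duals and transposes\<close>

text \<open>
  The space \<open>L\<^sup>1(\<nu>)\<close> depends on the measure \<open>\<nu>\<close> and hence is not a type. Real normed spaces are
  therefore given by a carrier set and operations on it. Functionals are made extensional
  (\<open>undefined\<close> off the carrier), so that equal functionals are equal as HOL functions.
\<close>

record 'v nspace =
  ncarrier :: "'v set"
  nadd :: "'v \<Rightarrow> 'v \<Rightarrow> 'v"
  nzero :: "'v"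
  nscale :: "real \<Rightarrow> 'v \<Rightarrow> 'v"
  nnorm :: "'v \<Rightarrow> real"

definition ndual :: "'v nspace \<Rightarrow> ('v \<Rightarrow> real) nspace" where
  "ndual V = \<lparr>
     ncarrier = {l \<in> extensional (ncarrier V).
        (\<forall>u\<in>ncarrier V. \<forall>v\<in>ncarrier V. l (nadd V u v) = l u + l v) \<and>
        (\<forall>c. \<forall>u\<in>ncarrier V. l (nscale V c u) = c * l u) \<and>
        (\<exists>K. \<forall>u\<in>ncarrier V. \<bar>l u\<bar> \<le> K * nnorm V u)},
     nadd = (\<lambda>l m. \<lambda>u\<in>ncarrier V. l u + m u),
     nzero = (\<lambda>u\<in>ncarrier V. 0),
     nscale = (\<lambda>c l. \<lambda>u\<in>ncarrier V. c * l u),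
     nnorm = (\<lambda>l. SUP u\<in>{u \<in> ncarrier V. nnorm V u \<le> 1}. \<bar>l u\<bar>) \<rparr>"

definition nbounded_linear :: "'v nspace \<Rightarrow> ('v \<Rightarrow> 'v) \<Rightarrow> bool" where
  "nbounded_linear V T \<longleftrightarrow>
     T \<in> ncarrier V \<rightarrow> ncarrier V \<and>
     (\<forall>u\<in>ncarrier V. \<forall>v\<in>ncarrier V. T (nadd V u v) = nadd V (T u) (T v)) \<and>
     (\<forall>c. \<forall>u\<in>ncarrier V. T (nscale V c u) = nscale V c (T u)) \<and>
     (\<exists>K. \<forall>u\<in>ncarrier V. nnorm V (T u) \<le> K * nnorm V u)"

definition ntranspose :: "'v nspace \<Rightarrow> ('v \<Rightarrow> 'v) \<Rightarrow> ('v \<Rightarrow> real) \<Rightarrow> ('v \<Rightarrow> real)" where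
  "ntranspose V T = (\<lambda>l\<in>ncarrier (ndual V). \<lambda>u\<in>ncarrier V. l (T u))"

definition ncanonical :: "'v nspace \<Rightarrow> 'v \<Rightarrow> ('v \<Rightarrow> real) \<Rightarrow> real" where
  "ncanonical V u = (\<lambda>l\<in>ncarrier (ndual V). l u)"

definition neigenvector :: "'v nspace \<Rightarrow> ('v \<Rightarrow> 'v) \<Rightarrow> real \<Rightarrow> 'v \<Rightarrow> bool" where
  "neigenvector V T c v \<longleftrightarrow> v \<in> ncarrier V \<and> v \<noteq> nzero V \<and> T v = nscale V c v"

text \<open>The topology on the dual of \<open>V\<close> of pointwise convergence on \<open>V\<close>.\<close>

definition weak_star_topology :: "'v nspace \<Rightarrow> ('v \<Rightarrow> real) topology" where
  "weak_star_topology V =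
     subtopology (product_topology (\<lambda>_. euclideanreal) (ncarrier V)) (ncarrier (ndual V))"

section \<open>Nets\<close>

definition directed_on :: "'d set \<Rightarrow> ('d \<Rightarrow> 'd \<Rightarrow> bool) \<Rightarrow> bool" where
  "directed_on D le \<longleftrightarrow> D \<noteq> {} \<and> (\<forall>a\<in>D. le a a) \<and>
     (\<forall>a\<in>D. \<forall>b\<in>D. \<forall>c\<in>D. le a b \<longrightarrow> le b c \<longrightarrow> le a c) \<and>
     (\<forall>a\<in>D. \<forall>b\<in>D. \<exists>c\<in>D. le a c \<and> le b c)"

definition net_filter :: "'d set \<Rightarrow> ('d \<Rightarrow> 'd \<Rightarrow> bool) \<Rightarrow> 'd filter" where
  "net_filter D le = (INF a\<in>D. principal {b \<in> D. le a b})"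

text \<open>
  The net \<open>d \<mapsto> s (h d)\<close> is a subnet, in the sense of Kelley, of a sequence \<open>s\<close>. The map \<open>h\<close>
  need not be monotone, so Willard's subnets (and subsequences) are covered.
\<close>

definition subnet_index :: "'d set \<Rightarrow> ('d \<Rightarrow> 'd \<Rightarrow> bool) \<Rightarrow> ('d \<Rightarrow> nat) \<Rightarrow> bool" where
  "subnet_index D le h \<longleftrightarrow> directed_on D le \<and>
     (\<forall>N. \<exists>a\<in>D. \<forall>b\<in>D. le a b \<longrightarrow> N \<le> h b)"

lemma eventually_net_filter:
  assumes "directed_on D le"
  shows "eventually P (net_filter D le) \<longleftrightarrow> (\<exists>a\<in>D. \<forall>b\<in>D. le a b \<longrightarrow> P b)"
proof -
  have "eventually P (net_filter D le) \<longleftrightarrow>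
      (\<exists>a\<in>D. eventually P (principal {b \<in> D. le a b}))"
    unfolding net_filter_def
  proof (rule eventually_INF_base)
    show "D \<noteq> {}" using assms by (simp add: directed_on_def)
    fix a b assume "a \<in> D" "b \<in> D"
    then obtain c where "c \<in> D" "le a c" "le b c"
      using assms unfolding directed_on_def by blast
    show "\<exists>x\<in>D. principal {e \<in> D. le x e}
        \<le> inf (principal {e \<in> D. le a e}) (principal {e \<in> D. le b e})"
    proof (intro bexI[of _ c])
      have "{e \<in> D. le c e} \<subseteq> {e \<in> D. le a e} \<inter> {e \<in> D. le b e}"
        using assms \<open>a \<in> D\<close> \<open>b \<in> D\<close> \<open>c \<in> D\<close> \<open>le a c\<close> \<open>le b c\<close>
        unfolding directed_on_def by blast
      then show "principal {e \<in> D. le c e}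
          \<le> inf (principal {e \<in> D. le a e}) (principal {e \<in> D. le b e})"
        by simp
    qed fact
  qed
  then show ?thesis by (auto simp: eventually_principal)
qed

section \<open>The space of integrable functions modulo almost everywhere equality\<close>

definition ae_class :: "'a measure \<Rightarrow> ('a \<Rightarrow> real) \<Rightarrow> ('a \<Rightarrow> real) set" where
  "ae_class M g = {h. integrable M h \<and> (AE x in M. h x = g x)}"

definition class_rep :: "('a \<Rightarrow> real) set \<Rightarrow> 'a \<Rightarrow> real" where
  "class_rep U = (SOME g. g \<in> U)"

definition L1 :: "'a measure \<Rightarrow> ('a \<Rightarrow> real) set nspace" where
  "L1 M = \<lparr>
     ncarrier = ae_class M ` {g. integrable M g},
     nadd = (\<lambda>U V. ae_class M (\<lambda>x. class_rep U x + class_rep V x)),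
     nzero = ae_class M (\<lambda>x. 0),
     nscale = (\<lambda>c U. ae_class M (\<lambda>x. c * class_rep U x)),
     nnorm = (\<lambda>U. \<integral>x. \<bar>class_rep U x\<bar> \<partial>M) \<rparr>"

definition L1_nonneg :: "'a measure \<Rightarrow> ('a \<Rightarrow> real) set \<Rightarrow> bool" where
  "L1_nonneg M U \<longleftrightarrow> (AE x in M. 0 \<le> class_rep U x)"

definition L1_positive_op ::
  "'a measure \<Rightarrow> (('a \<Rightarrow> real) set \<Rightarrow> ('a \<Rightarrow> real) set) \<Rightarrow> bool" where
  "L1_positive_op M T \<longleftrightarrow> (\<forall>U\<in>ncarrier (L1 M). L1_nonneg M U \<longrightarrow> L1_nonneg M (T U))"

text \<open>The element \<open>1\<^sub>A\<nu>\<close> of the dual of \<open>L\<^sup>1(\<nu>)\<close>.\<close>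

definition ind_functional :: "'a measure \<Rightarrow> 'a set \<Rightarrow> ('a \<Rightarrow> real) set \<Rightarrow> real" where
  "ind_functional M A = (\<lambda>U\<in>ncarrier (L1 M). \<integral>x. indicator A x * class_rep U x \<partial>M)"

section \<open>The Ruelle operator\<close>

text \<open>
  A point \<open>(x\<^sub>1, x\<^sub>2, \<dots>)\<close> of \<open>E\<^sup>\<nat>\<close> is a function \<open>nat \<Rightarrow> 'e\<close> with \<open>x\<^sub>1\<close> at index \<open>0\<close>. The point \<open>ax\<close>
  is \<open>case_nat a x\<close>. Since \<open>E\<^sup>\<nat>\<close> is compact, \<open>C(X)\<close> is the library's space of bounded continuous
  functions.
\<close>

definition seq_shift :: "(nat \<Rightarrow> 'e) \<Rightarrow> (nat \<Rightarrow> 'e)" where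
  "seq_shift x = (\<lambda>n. x (Suc n))"

definition borel_probs :: "'a::topological_space measure set" where
  "borel_probs = {M. sets M = sets borel \<and> prob_space M}"

definition measure_support :: "'a::topological_space measure \<Rightarrow> 'a set" where
  "measure_support M = {x. \<forall>U. open U \<longrightarrow> x \<in> U \<longrightarrow> 0 < emeasure M U}"

definition ruelle :: "'e::metric_space measure \<Rightarrow> ((nat \<Rightarrow> 'e) \<Rightarrow> real) \<Rightarrow>
    ((nat \<Rightarrow> 'e) \<Rightarrow>\<^sub>C real) \<Rightarrow> ((nat \<Rightarrow> 'e) \<Rightarrow>\<^sub>C real)" where
  "ruelle p f \<phi> =
     Bcontfun (\<lambda>x. \<integral>a. exp (f (case_nat a x)) * apply_bcontfun \<phi> (case_nat a x) \<partial>p)"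

lemma compact_UNIV_seq:
  assumes "compact (UNIV :: 'e::metric_space set)"
  shows "compact (UNIV :: (nat \<Rightarrow> 'e) set)"
proof -
  have "compact_space (euclidean :: 'e topology)"
    using assms by (simp add: compact_space_def)
  then have "compact_space (product_topology (\<lambda>_::nat. euclidean :: 'e topology) UNIV)"
    by (simp add: compact_space_product_topology)
  then show ?thesis
    unfolding euclidean_product_topology by (simp add: compact_space_def)
qed

text \<open>The function under \<^const>\<open>Bcontfun\<close> does lie in \<^const>\<open>bcontfun\<close>:\<close>

lemma ruelle_apply:
  fixes p :: "'e::metric_space measure"
  assumes E: "compact (UNIV :: 'e set)" and p: "p \<in> borel_probs"
    and f: "continuous_on UNIV f"
  shows "apply_bcontfun (ruelle p f \<phi>) x =
    (\<integral>a. exp (f (case_nat a x)) * apply_bcontfun \<phi> (case_nat a x) \<partial>p)"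
proof -
  interpret prob_space p using p by (simp add: borel_probs_def)
  have sp: "sets p = sets borel" using p by (simp add: borel_probs_def)
  define g where "g y = exp (f y) * apply_bcontfun \<phi> y" for y
  define F where "F x = (\<integral>a. g (case_nat a x) \<partial>p)" for x
  have g: "continuous_on UNIV g"
    unfolding g_def by (intro continuous_intros f) simp
  have "compact (range g)"
    using compact_UNIV_seq[OF E] g by (rule compact_continuous_image[rotated])
  then obtain B where B: "\<And>y. norm (g y) \<le> B"
    using compact_imp_bounded bounded_iff by (metis rangeI)
  have c1: "continuous_on UNIV (\<lambda>a. case_nat a x :: nat \<Rightarrow> 'e)" for x
  proof (rule continuous_on_coordinatewise_then_product)
    show "continuous_on UNIV (\<lambda>a. (case_nat a x :: nat \<Rightarrow> 'e) i)" for i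
      by (cases i) auto
  qed
  have c2: "continuous_on UNIV (\<lambda>x. case_nat a x :: nat \<Rightarrow> 'e)" for a
  proof (rule continuous_on_coordinatewise_then_product)
    show "continuous_on UNIV (\<lambda>x. (case_nat a x :: nat \<Rightarrow> 'e) i)" for i
      by (cases i) (auto intro: continuous_on_product_coordinates)
  qed
  have m: "(\<lambda>a. g (case_nat a x)) \<in> borel_measurable p" for x
  proof -
    have "(\<lambda>a. g (case_nat a x)) \<in> borel_measurable borel"
      by (rule borel_measurable_continuous_onI, rule continuous_on_compose2[OF g c1]) simp
    then show ?thesis by (simp add: measurable_cong_sets[OF sp refl])
  qed
  have "continuous_on UNIV F"
    unfolding continuous_on_sequentially comp_def
  proof (intro allI ballI impI, elim conjE)
    fix s :: "nat \<Rightarrow> nat \<Rightarrow> 'e" and x assume s: "s \<longlonglongrightarrow> x"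
    show "(\<lambda>n. F (s n)) \<longlonglongrightarrow> F x"
      unfolding F_def
    proof (rule integral_dominated_convergence[where w = "\<lambda>_. B"])
      show "AE a in p. (\<lambda>n. g (case_nat a (s n))) \<longlonglongrightarrow> g (case_nat a x)"
        using continuous_on_tendsto_compose[OF continuous_on_compose2[OF g c2] s] by auto
    qed (use m B in auto)
  qed
  moreover have "norm (F x) \<le> B" for x
  proof -
    have "norm (F x) \<le> (\<integral>a. norm (g (case_nat a x)) \<partial>p)"
      unfolding F_def by (rule integral_norm_bound)
    also have "\<dots> \<le> (\<integral>a. B \<partial>p)"
      using m B order_trans[OF norm_ge_zero B] by (intro integral_mono integrable_const_bound[where B = B]) auto
    finally show ?thesis by (simp add: prob_space)
  qed
  ultimately have "F \<in> bcontfun" by (auto simp: bcontfun_def bounded_iff)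
  then show ?thesis
    unfolding ruelle_def F_def g_def by (simp add: Bcontfun_inverse)
qed

abbreviation ruelle_radius :: "'e::metric_space measure \<Rightarrow> ((nat \<Rightarrow> 'e) \<Rightarrow> real) \<Rightarrow> real" where
  "ruelle_radius p f \<equiv> op_spectral_radius (ruelle p f)"

text \<open>
  Measures are identified with the functionals they induce on \<open>C(X)\<close>, so that the transpose
  of the Ruelle operator acts by composition.
\<close>

definition measure_functional ::
  "(nat \<Rightarrow> 'e::metric_space) measure \<Rightarrow> ((nat \<Rightarrow> 'e) \<Rightarrow>\<^sub>C real) \<Rightarrow> real" where
  "measure_functional \<mu> \<phi> = (\<integral>x. apply_bcontfun \<phi> x \<partial>\<mu>)"

definition ruelle_dual :: "'e::metric_space measure \<Rightarrow> ((nat \<Rightarrow> 'e) \<Rightarrow> real) \<Rightarrow>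
    (((nat \<Rightarrow> 'e) \<Rightarrow>\<^sub>C real) \<Rightarrow> real) \<Rightarrow> (((nat \<Rightarrow> 'e) \<Rightarrow>\<^sub>C real) \<Rightarrow> real)" where
  "ruelle_dual p f l = l \<circ> ruelle p f"

definition Gstar ::
  "'e::metric_space measure \<Rightarrow> ((nat \<Rightarrow> 'e) \<Rightarrow> real) \<Rightarrow> (nat \<Rightarrow> 'e) measure set" where
  "Gstar p f = {\<nu> \<in> borel_probs. ruelle_dual p f (measure_functional \<nu>) =
     (\<lambda>\<phi>. ruelle_radius p f * measure_functional \<nu> \<phi>)}"

definition L1_extension :: "'e::metric_space measure \<Rightarrow> ((nat \<Rightarrow> 'e) \<Rightarrow> real) \<Rightarrow>
    (nat \<Rightarrow> 'e) measure \<Rightarrow> (((nat \<Rightarrow> 'e) \<Rightarrow> real) set \<Rightarrow> ((nat \<Rightarrow> 'e) \<Rightarrow> real) set) \<Rightarrow> bool" where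
  "L1_extension p f \<nu> T \<longleftrightarrow> nbounded_linear (L1 \<nu>) T \<and> L1_positive_op \<nu> T \<and>
     (\<forall>\<phi>. T (ae_class \<nu> (apply_bcontfun \<phi>)) = ae_class \<nu> (apply_bcontfun (ruelle p f \<phi>)))"

definition xi_seq :: "'e::metric_space measure \<Rightarrow> ((nat \<Rightarrow> 'e) \<Rightarrow> real) \<Rightarrow>
    (nat \<Rightarrow> 'e) measure \<Rightarrow> (((nat \<Rightarrow> 'e) \<Rightarrow> real) set \<Rightarrow> ((nat \<Rightarrow> 'e) \<Rightarrow> real) set) \<Rightarrow>
    nat \<Rightarrow> (((nat \<Rightarrow> 'e) \<Rightarrow> real) set \<Rightarrow> real) \<Rightarrow> real" where
  "xi_seq p f \<nu> T n = nscale (ndual (ndual (L1 \<nu>))) (1 / ruelle_radius p f ^ n)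
     (ncanonical (L1 \<nu>) ((T ^^ n) (ae_class \<nu> (\<lambda>x. 1))))"

end

theory Submission
  imports Defs
begin

text \<open>
  The key identity is \<open>T\<^sup>*(1\<^sub>A\<nu>) = \<rho> 1\<^sub>B\<nu>\<close> with \<open>B = \<sigma>\<^sup>-\<^sup>1(A)\<close> and \<open>\<rho> = \<rho>(L\<^sub>f)\<close>. For continuous \<open>g\<close>
  in place of \<open>1\<^sub>A\<close>, tested against continuous \<open>\<phi>\<close>, it follows from \<open>L\<^sub>f((g \<circ> \<sigma>) \<phi>) = g L\<^sub>f \<phi>\<close>
  by integrating against the eigenmeasure \<open>\<nu>\<close>; a monotone class argument replaces \<open>g\<close> by \<open>1\<^sub>A\<close>, and
  another one \<open>\<phi>\<close> by an element of \<open>L\<^sup>1(\<nu>)\<close>. Applying \<open>\<xi>\<^sub>f\<close> and cancelling the eigenvalue, which is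
  positive because \<open>\<rho> = \<integral> L\<^sub>f 1 d\<nu>\<close>, yields shift invariance. Non-negativity passes from the
  \<open>\<xi>\<^sub>n\<close> to the limit, and additivity is the linearity of \<open>\<xi>\<^sub>f\<close>.
\<close>

section \<open>Functionals determined by continuous functions\<close>

text \<open>Off \<open>F\<close> the distance to \<open>F\<close> is positive because
  \<open>F\<close> is closed, so the bump vanishes once \<open>n\<close> exceeds its reciprocal. The
  empty set is excluded because \<open>infdist x {}\<close> is 0 by convention, which would make
  every bump equal to 1.\<close>

lemma tendsto_indicator_closed:
  fixes F :: "'a::metric_space set"
  assumes "closed F" "F \<noteq> {}"
  shows "(\<lambda>n. max 0 (1 - real n * infdist x F)) \<longlonglongrightarrow> indicator F x"
proof (cases "x \<in> F")
  case True
  then show ?thesis by simp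
next
  case False
  then have d: "0 < infdist x F"
    using assms in_closed_iff_infdist_zero[of F x] infdist_nonneg[of x F] by auto
  obtain N :: nat where N: "1 / infdist x F < real N"
    using reals_Archimedean2 by blast
  have "max 0 (1 - real n * infdist x F) = 0" if "n \<ge> N" for n
  proof -
    have "1 / infdist x F < real n" using N that by simp
    then show ?thesis using d by (simp add: field_simps)
  qed
  then have "eventually (\<lambda>n. max 0 (1 - real n * infdist x F) = 0) sequentially"
    by (auto simp: eventually_sequentially)
  then show ?thesis
    using False by (simp add: tendsto_eventually)
qed

text \<open>The Borel sets with \<Lambda>-value 0 form a Dynkin system containing the closed sets,
  an intersection-stable generator. Linearity is required only for differences of indicators, since
  the integral expressions substituted for \<Lambda> are linear only on integrable
  functions.\<close>

lemma functional_zero_on_indicators: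
  fixes \<Lambda> :: "('a::metric_space \<Rightarrow> real) \<Rightarrow> real"
  assumes diff: "\<And>A B. A \<in> sets borel \<Longrightarrow> B \<in> sets borel \<Longrightarrow>
      \<Lambda> (\<lambda>x. indicator A x - indicator B x) = \<Lambda> (indicator A) - \<Lambda> (indicator B)"
    and conv: "\<And>s u. (\<And>i. s i \<in> borel_measurable borel) \<Longrightarrow> (\<And>i x. \<bar>s i x\<bar> \<le> 1) \<Longrightarrow>
      u \<in> borel_measurable borel \<Longrightarrow> (\<And>x. (\<lambda>i. s i x) \<longlonglongrightarrow> u x) \<Longrightarrow> (\<lambda>i. \<Lambda> (s i)) \<longlonglongrightarrow> \<Lambda> u"
    and zero: "\<And>g. continuous_on UNIV g \<Longrightarrow> \<Lambda> g = 0"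
    and A: "A \<in> sets borel"
  shows "\<Lambda> (indicator A) = 0"
proof -
  have "Int_stable (Collect closed :: 'a set set)" "Collect closed \<subseteq> Pow (UNIV :: 'a set)"
    by (auto simp: Int_stable_def)
  moreover have "A \<in> sigma_sets UNIV (Collect closed)"
    using A by (simp add: borel_eq_closed)
  ultimately show ?thesis
  proof (induction rule: sigma_sets_induct_disjoint)
    case (basic F)
    show ?case
    proof (cases "F = {}")
      case True
      then show ?thesis using zero[of "\<lambda>x. 0"] by (simp add: indicator_def[abs_def])
    next
      case False
      have "(\<lambda>i. \<Lambda> (\<lambda>x. max 0 (1 - real i * infdist x F))) \<longlonglongrightarrow> \<Lambda> (indicator F)"
      proof (rule conv)
        show "(\<lambda>x. max 0 (1 - real i * infdist x F)) \<in> borel_measurable borel" for i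
          by (intro borel_measurable_continuous_onI continuous_intros)
        show "indicator F \<in> borel_measurable borel"
          using basic by auto
        show "(\<lambda>i. max 0 (1 - real i * infdist x F)) \<longlonglongrightarrow> indicator F x" for x
          using tendsto_indicator_closed basic False by auto
      qed (auto simp: infdist_nonneg max_def)
      moreover have "\<Lambda> (\<lambda>x. max 0 (1 - real i * infdist x F)) = 0" for i
        by (intro zero continuous_intros)
      ultimately show ?thesis by (simp add: LIMSEQ_const_iff)
    qed
  next
    case empty
    then show ?case using zero[of "\<lambda>x. 0"] by (simp add: indicator_def[abs_def])
  next
    case (compl B)
    have "B \<in> sets borel" using compl by (simp add: borel_eq_closed)
    \<comment> \<open>Complements reduce to \<open>diff\<close> against the whole space, whose
      indicator is the continuous constant 1.\<close>
    moreover have "indicator (UNIV - B) = (\<lambda>x. indicator UNIV x - indicator B x :: real)"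
      by (auto simp: indicator_def)
    moreover have "\<Lambda> (indicator UNIV) = 0"
      using zero[of "\<lambda>x. 1"] by (simp add: indicator_def[abs_def])
    ultimately show ?case using diff[of UNIV B] compl by simp
  next
    case (union B)
    have B: "B i \<in> sets borel" for i using union by (auto simp: borel_eq_closed)
    \<comment> \<open>Partial unions bring in \<open>diff\<close>: by disjointness the indicator of
      \<open>B n\<close> is the increment from \<open>S n\<close> to \<open>S (Suc n)\<close>. They
      converge pointwise to the full union with values bounded by 1, as \<open>conv\<close>
      demands.\<close>
    define S where "S n = (\<Union>i<n. B i)" for n
    have S: "S n \<in> sets borel" for n unfolding S_def using B by auto
    have "\<Lambda> (indicator (S n)) = 0" for n
    proof (induction n)
      case 0
      then show ?case using zero[of "\<lambda>x. 0"] by (simp add: S_def indicator_def[abs_def])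
    next
      case (Suc n)
      have "B i \<inter> B n = {}" if "i < n" for i
        using disjoint_family_onD[OF union(1), of i n] that by simp
      then have "S n \<inter> B n = {}"
        unfolding S_def by blast
      moreover have "S (Suc n) = B n \<union> S n"
        by (simp add: S_def lessThan_Suc)
      ultimately have "indicator (B n) = (\<lambda>x. indicator (S (Suc n)) x - indicator (S n) x :: real)"
        by (auto simp: fun_eq_iff split: split_indicator)
      then have "\<Lambda> (indicator (B n)) = \<Lambda> (indicator (S (Suc n))) - \<Lambda> (indicator (S n))"
        using diff[OF S[of "Suc n"] S[of n]] by simp
      then show ?case using Suc.IH union(3)[of n] by simp
    qed
    moreover have "(\<lambda>n. \<Lambda> (indicator (S n))) \<longlonglongrightarrow> \<Lambda> (indicator (\<Union>i. B i))"
    proof (rule conv)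
      show "(\<lambda>n. indicator (S n) x) \<longlonglongrightarrow> (indicator (\<Union>i. B i) x :: real)" for x
        unfolding S_def by (rule LIMSEQ_indicator_UN)
      show "indicator (S n) \<in> borel_measurable borel" for n
        using S by (rule borel_measurable_indicator)
      show "indicator (\<Union>i. B i) \<in> borel_measurable borel"
        using B by (intro borel_measurable_indicator) auto
    qed simp
    ultimately show ?case by (simp add: LIMSEQ_const_iff)
  qed
qed

text \<open>This is density of the continuous functions in \<open>L1 M\<close>, phrased for
  functionals: the bound by the L1 norm makes \<Lambda> continuous along dominated sequences, so its
  vanishing spreads from continuous functions to indicators and then, by
  \<open>integrable_induct\<close>, to all integrable functions.\<close>

lemma L1_functional_zero:
  fixes M :: "'a::metric_space measure" and \<Lambda> :: "('a \<Rightarrow> real) \<Rightarrow> real"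
  assumes M: "finite_measure M" "sets M = sets borel"
    and add: "\<And>u v. integrable M u \<Longrightarrow> integrable M v \<Longrightarrow> \<Lambda> (\<lambda>x. u x + v x) = \<Lambda> u + \<Lambda> v"
    and scale: "\<And>c u. integrable M u \<Longrightarrow> \<Lambda> (\<lambda>x. c * u x) = c * \<Lambda> u"
    and bound: "\<And>u. integrable M u \<Longrightarrow> \<bar>\<Lambda> u\<bar> \<le> K * (\<integral>x. \<bar>u x\<bar> \<partial>M)"
    and zero: "\<And>g. continuous_on UNIV g \<Longrightarrow> \<Lambda> g = 0"
    and u: "integrable M u"
  shows "\<Lambda> u = 0"
proof -
  interpret finite_measure M by fact
  note [measurable_cong] = M(2)
  have diff: "\<Lambda> (\<lambda>x. u x - v x) = \<Lambda> u - \<Lambda> v" if "integrable M u" "integrable M v" for u v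
    using add[of u "\<lambda>x. (-1) * v x"] scale[of v "-1"] that by simp
  \<comment> \<open>Dominated convergence gives convergence in the L1 norm, and \<open>bound\<close>
    transfers it to \<Lambda>. The dominating function \<open>w\<close> is left free: it is a
    constant for indicators and depends on the limit in the final induction.\<close>
  have conv: "(\<lambda>i. \<Lambda> (s i)) \<longlonglongrightarrow> \<Lambda> u"
    if s: "\<And>i. s i \<in> borel_measurable M" and u: "u \<in> borel_measurable M"
      and w: "integrable M w" and b: "\<And>i x. x \<in> space M \<Longrightarrow> \<bar>s i x\<bar> \<le> w x"
      and l: "\<And>x. x \<in> space M \<Longrightarrow> (\<lambda>i. s i x) \<longlonglongrightarrow> u x" for s u w
  proof -
    have si: "integrable M (s i)" for i
      by (rule Bochner_Integration.integrable_bound[OF w s])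
        (use order_trans[OF b abs_ge_self] in auto)
    have ui: "integrable M u"
      by (rule integrable_dominated_convergence[OF u s w, of "\<lambda>i. i"]) (use l b in auto)
    have "(\<lambda>i. \<integral>x. \<bar>s i x - u x\<bar> \<partial>M) \<longlonglongrightarrow> (\<integral>x. 0 \<partial>M)"
    proof (rule integral_dominated_convergence[where w = "\<lambda>x. w x + \<bar>u x\<bar>"])
      show "AE x in M. (\<lambda>i. \<bar>s i x - u x\<bar>) \<longlonglongrightarrow> 0"
        using l by (auto intro!: AE_I2 tendsto_rabs_zero simp: LIM_zero)
      show "AE x in M. norm \<bar>s i x - u x\<bar> \<le> w x + \<bar>u x\<bar>" for i
        using b[of _ i] by (intro AE_I2) fastforce
    qed (use s u w ui in auto)
    then have lim: "(\<lambda>i. K * (\<integral>x. \<bar>s i x - u x\<bar> \<partial>M)) \<longlonglongrightarrow> 0"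
      by (auto intro: tendsto_mult_right_zero)
    have "(\<lambda>i. \<Lambda> (s i) - \<Lambda> u) \<longlonglongrightarrow> 0"
    proof (rule tendsto_rabs_zero_cancel, rule tendsto_sandwich[OF _ _ tendsto_const lim])
      show "\<forall>\<^sub>F i in sequentially. \<bar>\<Lambda> (s i) - \<Lambda> u\<bar> \<le> K * (\<integral>x. \<bar>s i x - u x\<bar> \<partial>M)"
        using bound[OF Bochner_Integration.integrable_diff[OF si ui]] diff[OF si ui] by simp
    qed simp
    then show ?thesis by (simp add: LIM_zero_iff)
  qed
  have ind: "\<Lambda> (indicator A) = 0" if A: "A \<in> sets M" for A
  proof (rule functional_zero_on_indicators)
    show "A \<in> sets borel" using A M by simp
    show "\<Lambda> (\<lambda>x. indicator A x - indicator B x) = \<Lambda> (indicator A) - \<Lambda> (indicator B)"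
      if "A \<in> sets borel" "B \<in> sets borel" for A B
      by (rule diff) (use that M in \<open>auto intro!: integrable_const_bound[where B = 1]\<close>)
    show "(\<lambda>i. \<Lambda> (s i)) \<longlonglongrightarrow> \<Lambda> u"
      if "\<And>i. s i \<in> borel_measurable borel" "\<And>i x. \<bar>s i x\<bar> \<le> 1"
        "u \<in> borel_measurable borel" "\<And>x. (\<lambda>i. s i x) \<longlonglongrightarrow> u x" for s u
      by (rule conv[where w = "\<lambda>_. 1"]) (use that in auto)
  qed (rule zero)
  from u show ?thesis
  proof (induction rule: integrable_induct)
    case (base A c)
    then show ?case
      using scale[of "indicator A" c] ind[of A] by (simp add: mult.commute)
  next
    case (add u v)
    then show ?case using assms(3) by simp
  next
    case (lim u s)
    have "(\<lambda>i. \<Lambda> (s i)) \<longlonglongrightarrow> \<Lambda> u"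
      \<comment> \<open>The factor 2 is the domination of the approximating sequence that
        \<open>integrable_induct\<close> provides.\<close>
      by (rule conv[where w = "\<lambda>x. 2 * norm (u x)"]) (use lim in auto)
    then show ?case using lim by (simp add: LIMSEQ_const_iff)
  qed
qed

section \<open>Integrable functions modulo almost everywhere equality\<close>

text \<open>An integrable \<open>g\<close> lies in its own class, so the choice is from a nonempty
  set. The operations of \<open>L1\<close> use chosen representatives; this fact allows computing
  with any integrable representative instead.\<close>

lemma class_rep_ae_class:
  assumes "integrable M g"
  shows "integrable M (class_rep (ae_class M g))" "AE x in M. class_rep (ae_class M g) x = g x"
proof -
  have "g \<in> ae_class M g" using assms by (simp add: ae_class_def)
  then have "class_rep (ae_class M g) \<in> ae_class M g"
    unfolding class_rep_def by (rule someI[where P = "\<lambda>h. h \<in> ae_class M g"])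
  then show "integrable M (class_rep (ae_class M g))"
    "AE x in M. class_rep (ae_class M g) x = g x"
    by (auto simp: ae_class_def)
qed

lemma ae_class_cong:
  assumes "AE x in M. g x = h x"
  shows "ae_class M g = ae_class M h"
proof -
  have "(AE x in M. k x = g x) \<longleftrightarrow> (AE x in M. k x = h x)" for k
    by (rule eventually_subst) (use assms in \<open>eventually_elim, simp\<close>)
  then show ?thesis by (simp add: ae_class_def)
qed

lemma ncarrier_L1I: "integrable M g \<Longrightarrow> ae_class M g \<in> ncarrier (L1 M)"
  by (simp add: L1_def)

lemma ncarrier_L1E:
  assumes "U \<in> ncarrier (L1 M)"
  obtains g where "integrable M g" "U = ae_class M g"
  using assms by (auto simp: L1_def)

lemma nadd_L1:
  assumes "integrable M g" "integrable M h"
  shows "nadd (L1 M) (ae_class M g) (ae_class M h) = ae_class M (\<lambda>x. g x + h x)"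
proof -
  have "AE x in M. class_rep (ae_class M g) x + class_rep (ae_class M h) x = g x + h x"
    using class_rep_ae_class(2)[OF assms(1)] class_rep_ae_class(2)[OF assms(2)] by eventually_elim simp
  then show ?thesis by (simp add: L1_def ae_class_cong)
qed

lemma nscale_L1:
  assumes "integrable M g"
  shows "nscale (L1 M) c (ae_class M g) = ae_class M (\<lambda>x. c * g x)"
proof -
  have "AE x in M. c * class_rep (ae_class M g) x = c * g x"
    using class_rep_ae_class(2)[OF assms] by eventually_elim simp
  then show ?thesis by (simp add: L1_def ae_class_cong)
qed

lemma integral_class_rep:
  assumes "integrable M g" "w \<in> borel_measurable M"
  shows "(\<integral>x. w x * class_rep (ae_class M g) x \<partial>M) = (\<integral>x. w x * g x \<partial>M)"
proof (rule integral_cong_AE)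
  show "AE x in M. w x * class_rep (ae_class M g) x = w x * g x"
    using class_rep_ae_class(2)[OF assms(1)] by eventually_elim simp
qed (use assms class_rep_ae_class(1)[OF assms(1)] in auto)

lemma nnorm_L1:
  assumes "integrable M g"
  shows "nnorm (L1 M) (ae_class M g) = (\<integral>x. \<bar>g x\<bar> \<partial>M)"
proof -
  have "(\<integral>x. \<bar>class_rep (ae_class M g) x\<bar> \<partial>M) = (\<integral>x. \<bar>g x\<bar> \<partial>M)"
  proof (rule integral_cong_AE)
    show "AE x in M. \<bar>class_rep (ae_class M g) x\<bar> = \<bar>g x\<bar>"
      using class_rep_ae_class(2)[OF assms] by eventually_elim simp
  qed (use assms class_rep_ae_class(1)[OF assms] in auto)
  then show ?thesis by (simp add: L1_def)
qed

lemma ind_functional_apply: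
  assumes "integrable M g" "A \<in> sets M"
  shows "ind_functional M A (ae_class M g) = (\<integral>x. indicator A x * g x \<partial>M)"
  using assms by (simp add: ind_functional_def ncarrier_L1I integral_class_rep)

lemma integrable_indicator_mult:
  fixes g :: "'a \<Rightarrow> real"
  assumes "integrable M g" "A \<in> sets M"
  shows "integrable M (\<lambda>x. indicator A x * g x)"
  using integrable_mult_indicator[OF assms(2,1)] by simp

lemma ind_functional_bound:
  assumes A: "A \<in> sets M" and U: "U \<in> ncarrier (L1 M)"
  shows "\<bar>ind_functional M A U\<bar> \<le> nnorm (L1 M) U"
proof -
  from U obtain g where g: "integrable M g" "U = ae_class M g" by (rule ncarrier_L1E)
  have "\<bar>\<integral>x. indicator A x * g x \<partial>M\<bar> \<le> (\<integral>x. \<bar>indicator A x * g x\<bar> \<partial>M)"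
    by (rule integral_abs_bound)
  also have "\<dots> \<le> (\<integral>x. \<bar>g x\<bar> \<partial>M)"
    using g A by (intro integral_mono integrable_abs integrable_indicator_mult)
      (auto simp: indicator_def)
  finally show ?thesis using g A by (simp add: ind_functional_apply nnorm_L1)
qed

lemma ind_functional_nadd:
  assumes A: "A \<in> sets M" and U: "U \<in> ncarrier (L1 M)" and V: "V \<in> ncarrier (L1 M)"
  shows "ind_functional M A (nadd (L1 M) U V) = ind_functional M A U + ind_functional M A V"
proof -
  from U obtain g where g: "integrable M g" "U = ae_class M g" by (rule ncarrier_L1E)
  from V obtain h where h: "integrable M h" "V = ae_class M h" by (rule ncarrier_L1E)
  show ?thesis
    using g h A by (simp add: nadd_L1 ind_functional_apply distrib_left integrable_indicator_mult)
qed

lemma ind_functional_nscale: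
  assumes A: "A \<in> sets M" and U: "U \<in> ncarrier (L1 M)"
  shows "ind_functional M A (nscale (L1 M) c U) = c * ind_functional M A U"
proof -
  from U obtain g where g: "integrable M g" "U = ae_class M g" by (rule ncarrier_L1E)
  show ?thesis
    using g A by (simp add: nscale_L1 ind_functional_apply mult.left_commute)
qed

text \<open>The constant 1 bounds the functional. Membership is what lets the transposes and the
  canonical map, which are restricted to dual carriers, be evaluated at it.\<close>

lemma ind_functional_in_ndual:
  assumes "A \<in> sets M"
  shows "ind_functional M A \<in> ncarrier (ndual (L1 M))"
proof -
  have "\<exists>K. \<forall>u\<in>ncarrier (L1 M). \<bar>ind_functional M A u\<bar> \<le> K * nnorm (L1 M) u"
    using ind_functional_bound[OF assms] by (intro exI[of _ 1]) simp
  moreover have "ind_functional M A \<in> extensional (ncarrier (L1 M))"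
    by (simp add: ind_functional_def)
  ultimately show ?thesis
    using assms by (simp add: ndual_def ind_functional_nadd ind_functional_nscale)
qed

text \<open>Through this equation finite additivity of \<mu> becomes additivity of the limit
  functional. It holds as an equality of HOL functions because both sides are
  \<open>undefined\<close> off the carrier.\<close>

lemma ind_functional_Un:
  assumes "A \<in> sets M" "B \<in> sets M" "A \<inter> B = {}"
  shows "ind_functional M (A \<union> B) = nadd (ndual (L1 M)) (ind_functional M A) (ind_functional M B)"
proof
  fix U
  show "ind_functional M (A \<union> B) U
      = nadd (ndual (L1 M)) (ind_functional M A) (ind_functional M B) U"
  proof (cases "U \<in> ncarrier (L1 M)")
    case True
    then obtain g where g: "integrable M g" "U = ae_class M g" by (rule ncarrier_L1E)
    have "indicator (A \<union> B) x * g x = indicator A x * g x + indicator B x * g x" for x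
      using assms(3) by (auto simp: indicator_def)
    then show ?thesis
      using True g assms by (simp add: ndual_def ind_functional_apply integrable_indicator_mult)
  qed (simp add: ndual_def ind_functional_def)
qed

section \<open>The Ruelle operator and the shift\<close>

lemma continuous_on_seq_shift: "continuous_on UNIV (seq_shift :: (nat \<Rightarrow> 'e::topological_space) \<Rightarrow> _)"
  unfolding seq_shift_def
  by (intro continuous_on_coordinatewise_then_product continuous_on_product_coordinates)

lemma borel_measurable_seq_shift [measurable]:
  "(seq_shift :: (nat \<Rightarrow> 'e::topological_space) \<Rightarrow> _) \<in> borel \<rightarrow>\<^sub>M borel"
  by (rule borel_measurable_continuous_onI[OF continuous_on_seq_shift])

lemma continuous_obtain_bcontfun:
  fixes g :: "'a::topological_space \<Rightarrow> real"
  assumes "compact (UNIV :: 'a set)" "continuous_on UNIV g"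
  obtains \<phi> where "apply_bcontfun \<phi> = g"
proof -
  have "compact (range g)" using assms by (rule compact_continuous_image[rotated])
  then have "g \<in> bcontfun" using assms by (simp add: bcontfun_def compact_imp_bounded)
  then show ?thesis using that Bcontfun_inverse by blast
qed

lemma bcontfun_bounded_abs:
  fixes \<phi> :: "'a::topological_space \<Rightarrow>\<^sub>C real"
  shows "\<bar>apply_bcontfun \<phi> x\<bar> \<le> norm \<phi>"
  using norm_bounded[of \<phi> x] by simp

lemma Gstar_integral:
  assumes "\<nu> \<in> Gstar p f"
  shows "(\<integral>x. apply_bcontfun (ruelle p f \<phi>) x \<partial>\<nu>) = ruelle_radius p f * (\<integral>x. apply_bcontfun \<phi> x \<partial>\<nu>)"
  using assms unfolding Gstar_def ruelle_dual_def measure_functional_def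
  by (auto dest: fun_cong[where x = \<phi>])

section \<open>Consequences of the eigenmeasure equation\<close>

context
  fixes p :: "'e::metric_space measure" and f :: "(nat \<Rightarrow> 'e) \<Rightarrow> real"
    and \<nu> :: "(nat \<Rightarrow> 'e) measure"
  assumes E: "compact (UNIV :: 'e set)" and p: "p \<in> borel_probs"
    and f: "continuous_on UNIV f" and \<nu>: "\<nu> \<in> Gstar p f"
begin

lemma sets_\<nu> [measurable_cong]: "sets \<nu> = sets borel"
  using \<nu> by (simp add: Gstar_def borel_probs_def)

lemma prob_space_\<nu>: "prob_space \<nu>"
  using \<nu> by (simp add: Gstar_def borel_probs_def)

interpretation prob_space \<nu> by (rule prob_space_\<nu>)

lemma measurable_bcontfun [measurable]:
  "apply_bcontfun (\<phi> :: (nat \<Rightarrow> 'e) \<Rightarrow>\<^sub>C real) \<in> borel_measurable borel"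
  by (intro borel_measurable_continuous_onI) simp

lemma integrable_bcontfun: "integrable \<nu> (apply_bcontfun (\<phi> :: (nat \<Rightarrow> 'e) \<Rightarrow>\<^sub>C real))"
  by (rule integrable_const_bound[where B = "norm \<phi>"]) (auto intro: bcontfun_bounded_abs)

text \<open>Testing the eigenmeasure equation with the constant 1 expresses the eigenvalue as the
  integral of the image of 1, which is bounded below by a positive constant because \<open>f\<close>
  is bounded on the compact space.\<close>

lemma ruelle_radius_pos: "0 < ruelle_radius p f"
proof -
  interpret p: prob_space p using p by (simp add: borel_probs_def)
  have sp [measurable_cong]: "sets p = sets borel" using p by (simp add: borel_probs_def)
  obtain \<phi> :: "(nat \<Rightarrow> 'e) \<Rightarrow>\<^sub>C real" where \<phi>: "apply_bcontfun \<phi> = (\<lambda>_. 1)"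
    using continuous_obtain_bcontfun[OF compact_UNIV_seq[OF E], of "\<lambda>_. 1"] by auto
  \<comment> \<open>\<open>F\<close> is \<open>f\<close> seen as an element of C(X), so that its
    norm serves as the bound for |f|.\<close>
  obtain F :: "(nat \<Rightarrow> 'e) \<Rightarrow>\<^sub>C real" where F: "apply_bcontfun F = f"
    using continuous_obtain_bcontfun[OF compact_UNIV_seq[OF E] f] by auto
  have b: "\<bar>f x\<bar> \<le> norm F" for x using bcontfun_bounded_abs[of F x] F by simp
  have f_meas [measurable]: "f \<in> borel_measurable borel"
    using f by (rule borel_measurable_continuous_onI)
  have c [measurable]: "(\<lambda>a. case_nat a x :: nat \<Rightarrow> 'e) \<in> borel \<rightarrow>\<^sub>M borel" for x
  proof (intro borel_measurable_continuous_onI continuous_on_coordinatewise_then_product)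
    show "continuous_on UNIV (\<lambda>a. (case_nat a x :: nat \<Rightarrow> 'e) i)" for i by (cases i) auto
  qed
  have lower: "exp (- norm F) \<le> apply_bcontfun (ruelle p f \<phi>) x" for x
  proof -
    have "(\<integral>a. exp (- norm F) \<partial>p) \<le> (\<integral>a. exp (f (case_nat a x)) \<partial>p)"
    proof (rule integral_mono)
      show "integrable p (\<lambda>a. exp (f (case_nat a x)))"
        using b by (intro p.integrable_const_bound[where B = "exp (norm F)"])
          (auto intro: order_trans[OF abs_ge_self])
      show "exp (- norm F) \<le> exp (f (case_nat a x))" for a
        using b[of "case_nat a x"] by simp
    qed simp
    then show ?thesis by (simp add: ruelle_apply[OF E p f] \<phi> p.prob_space)
  qed
  have "0 < exp (- norm F)" by simp
  also have "\<dots> = (\<integral>x. exp (- norm F) \<partial>\<nu>)" by (simp add: prob_space)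
  also have "\<dots> \<le> (\<integral>x. apply_bcontfun (ruelle p f \<phi>) x \<partial>\<nu>)"
    by (intro integral_mono integrable_bcontfun lower) simp
  also have "\<dots> = ruelle_radius p f"
    using Gstar_integral[OF \<nu>, of \<phi>] by (simp add: \<phi> prob_space)
  finally show ?thesis .
qed

text \<open>Shifting \<open>case_nat a x\<close> gives back \<open>x\<close>, so a factor
  \<open>g\<close> composed with the shift is constant in \<open>a\<close> and leaves the integral
  over \<open>p\<close>. The function \<psi> below is \<phi> multiplied by this factor.\<close>

lemma ruelle_shift_integral:
  assumes g: "continuous_on UNIV g"
  shows "(\<integral>x. g x * apply_bcontfun (ruelle p f \<phi>) x \<partial>\<nu>)
    = ruelle_radius p f * (\<integral>x. g (seq_shift x) * apply_bcontfun \<phi> x \<partial>\<nu>)"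
proof -
  have "continuous_on UNIV (\<lambda>x. g (seq_shift x) * apply_bcontfun \<phi> x)"
    by (intro continuous_intros continuous_on_compose2[OF g continuous_on_seq_shift]) auto
  then obtain \<psi> where \<psi>: "apply_bcontfun \<psi> = (\<lambda>x. g (seq_shift x) * apply_bcontfun \<phi> x)"
    using continuous_obtain_bcontfun[OF compact_UNIV_seq[OF E]] by blast
  have "apply_bcontfun (ruelle p f \<psi>) x = g x * apply_bcontfun (ruelle p f \<phi>) x" for x
    by (simp add: ruelle_apply[OF E p f] \<psi> seq_shift_def mult.left_commute)
  then show ?thesis using Gstar_integral[OF \<nu>, of \<psi>] by (simp add: \<psi>)
qed

text \<open>With \<phi> fixed, the difference of the two sides, as a function \<Lambda> of
  \<open>g\<close>, vanishes on continuous \<open>g\<close> and respects bounded pointwise limits,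
  so the Dynkin argument applies.\<close>

lemma ruelle_shift_integral_indicator:
  assumes A: "A \<in> sets borel"
  shows "(\<integral>x. indicator A x * apply_bcontfun (ruelle p f \<phi>) x \<partial>\<nu>)
    = ruelle_radius p f * (\<integral>x. indicator A (seq_shift x) * apply_bcontfun \<phi> x \<partial>\<nu>)"
proof -
  define \<Lambda> where "\<Lambda> g = (\<integral>x. g x * apply_bcontfun (ruelle p f \<phi>) x \<partial>\<nu>)
    - ruelle_radius p f * (\<integral>x. g (seq_shift x) * apply_bcontfun \<phi> x \<partial>\<nu>)" for g
  have i: "integrable \<nu> (\<lambda>x. indicator A x * apply_bcontfun \<psi> x)" if "A \<in> sets borel"
    for A :: "(nat \<Rightarrow> 'e) set" and \<psi> :: "(nat \<Rightarrow> 'e) \<Rightarrow>\<^sub>C real"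
    using that by (intro integrable_indicator_mult integrable_bcontfun) (simp add: sets_\<nu>)
  have j: "integrable \<nu> (\<lambda>x. indicator A (seq_shift x) * apply_bcontfun \<psi> x)" if "A \<in> sets borel"
    for A :: "(nat \<Rightarrow> 'e) set" and \<psi> :: "(nat \<Rightarrow> 'e) \<Rightarrow>\<^sub>C real"
    using that by (intro integrable_const_bound[where B = "norm \<psi>"])
      (auto simp: indicator_def bcontfun_bounded_abs)
  \<comment> \<open>Used for both terms of \<Lambda>: for \<open>s i\<close> against the Ruelle
    image of \<phi>, and for \<open>s i\<close> composed with the shift against \<phi>
    itself.\<close>
  have lim: "(\<lambda>i. \<integral>x. s i x * apply_bcontfun \<psi> x \<partial>\<nu>) \<longlonglongrightarrow> (\<integral>x. u x * apply_bcontfun \<psi> x \<partial>\<nu>)"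
    if [measurable]: "\<And>i. s i \<in> borel_measurable borel" "u \<in> borel_measurable borel"
      and b: "\<And>i x. \<bar>s i x\<bar> \<le> 1" and l: "\<And>x. (\<lambda>i. s i x) \<longlonglongrightarrow> u x"
    for s and u :: "(nat \<Rightarrow> 'e) \<Rightarrow> real" and \<psi> :: "(nat \<Rightarrow> 'e) \<Rightarrow>\<^sub>C real"
  proof (rule integral_dominated_convergence[where w = "\<lambda>_. norm \<psi>"])
    show "AE x in \<nu>. norm (s i x * apply_bcontfun \<psi> x) \<le> norm \<psi>" for i
    proof (rule AE_I2)
      fix x
      show "norm (s i x * apply_bcontfun \<psi> x) \<le> norm \<psi>"
        using mult_mono[OF b[of i x] bcontfun_bounded_abs[of \<psi> x]] by (simp add: abs_mult)
    qed
    show "AE x in \<nu>. (\<lambda>i. s i x * apply_bcontfun \<psi> x) \<longlonglongrightarrow> u x * apply_bcontfun \<psi> x"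
      by (intro AE_I2 tendsto_mult tendsto_const l)
  qed auto
  have "\<Lambda> (indicator A) = 0"
  proof (rule functional_zero_on_indicators[OF _ _ _ A])
    show "\<Lambda> (\<lambda>x. indicator A x - indicator B x) = \<Lambda> (indicator A) - \<Lambda> (indicator B)"
      if "A \<in> sets borel" "B \<in> sets borel" for A B
      using i j that by (simp add: \<Lambda>_def left_diff_distrib right_diff_distrib)
    show "(\<lambda>i. \<Lambda> (s i)) \<longlonglongrightarrow> \<Lambda> u"
      if [measurable]: "\<And>i. s i \<in> borel_measurable borel"
        and b: "\<And>i x. \<bar>s i x\<bar> \<le> 1"
        and [measurable]: "u \<in> borel_measurable borel" and l: "\<And>x. (\<lambda>i. s i x) \<longlonglongrightarrow> u x" for s u
      unfolding \<Lambda>_def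
      by (intro tendsto_diff tendsto_mult tendsto_const lim) (auto intro: b l)
    show "\<Lambda> g = 0" if "continuous_on UNIV g" for g
      using ruelle_shift_integral[OF that] by (simp add: \<Lambda>_def)
  qed
  then show ?thesis by (simp add: \<Lambda>_def)
qed

text \<open>The difference \<Lambda> of the two sides is linear and bounded in the L1 norm. On
  continuous functions \<open>T\<close> acts as the Ruelle operator, so there \<Lambda> vanishes by
  the integral identity for indicators; density does the rest.\<close>

lemma ntranspose_ind_functional:
  assumes T: "L1_extension p f \<nu> T" and A: "A \<in> sets borel"
  shows "ntranspose (L1 \<nu>) T (ind_functional \<nu> A)
    = nscale (ndual (L1 \<nu>)) (ruelle_radius p f) (ind_functional \<nu> (seq_shift -` A))"
proof -
  have A\<nu> [measurable]: "A \<in> sets \<nu>" using A sets_\<nu> by simp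
  have A': "seq_shift -` A \<in> sets \<nu>"
    using measurable_sets[OF borel_measurable_seq_shift A] by (simp add: sets_\<nu>)
  have T_in: "T U \<in> ncarrier (L1 \<nu>)" if "U \<in> ncarrier (L1 \<nu>)" for U
    using T that by (auto simp: L1_extension_def nbounded_linear_def)
  have T_add: "T (nadd (L1 \<nu>) U V) = nadd (L1 \<nu>) (T U) (T V)"
    if "U \<in> ncarrier (L1 \<nu>)" "V \<in> ncarrier (L1 \<nu>)" for U V
    using T that by (auto simp: L1_extension_def nbounded_linear_def)
  have T_scale: "T (nscale (L1 \<nu>) c U) = nscale (L1 \<nu>) c (T U)" if "U \<in> ncarrier (L1 \<nu>)" for c U
    using T that by (auto simp: L1_extension_def nbounded_linear_def)
  obtain K where K: "\<And>U. U \<in> ncarrier (L1 \<nu>) \<Longrightarrow> nnorm (L1 \<nu>) (T U) \<le> K * nnorm (L1 \<nu>) U"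
    using T unfolding L1_extension_def nbounded_linear_def by blast
  define \<Lambda> where "\<Lambda> u = ind_functional \<nu> A (T (ae_class \<nu> u))
    - ruelle_radius p f * ind_functional \<nu> (seq_shift -` A) (ae_class \<nu> u)" for u
  have \<Lambda>: "\<Lambda> u = 0" if "integrable \<nu> u" for u
  proof (rule L1_functional_zero[where M = \<nu> and \<Lambda> = \<Lambda> and K = "K + ruelle_radius p f"])
    show "finite_measure \<nu>" by (rule finite_measure_axioms)
    show "sets \<nu> = sets borel" by (rule sets_\<nu>)
    show "integrable \<nu> u" by fact
  next
    fix u v :: "(nat \<Rightarrow> 'e) \<Rightarrow> real" assume "integrable \<nu> u" "integrable \<nu> v"
    then show "\<Lambda> (\<lambda>x. u x + v x) = \<Lambda> u + \<Lambda> v"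
      using A' by (simp add: \<Lambda>_def nadd_L1[symmetric] T_add T_in ncarrier_L1I
          ind_functional_nadd distrib_left)
  next
    fix c and u :: "(nat \<Rightarrow> 'e) \<Rightarrow> real" assume "integrable \<nu> u"
    then show "\<Lambda> (\<lambda>x. c * u x) = c * \<Lambda> u"
      using A' by (simp add: \<Lambda>_def nscale_L1[symmetric] T_scale T_in ncarrier_L1I
          ind_functional_nscale right_diff_distrib)
  next
    fix u :: "(nat \<Rightarrow> 'e) \<Rightarrow> real" assume "integrable \<nu> u"
    then have u: "ae_class \<nu> u \<in> ncarrier (L1 \<nu>)"
      and n: "nnorm (L1 \<nu>) (ae_class \<nu> u) = (\<integral>x. \<bar>u x\<bar> \<partial>\<nu>)"
      by (auto intro: ncarrier_L1I nnorm_L1)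
    have "\<bar>\<Lambda> u\<bar> \<le> \<bar>ind_functional \<nu> A (T (ae_class \<nu> u))\<bar>
        + \<bar>ruelle_radius p f * ind_functional \<nu> (seq_shift -` A) (ae_class \<nu> u)\<bar>"
      unfolding \<Lambda>_def by (rule abs_triangle_ineq4)
    \<comment> \<open>Indicator functionals have norm at most 1, so \<open>K\<close> from
      \<open>T\<close> and the positive eigenvalue are the only constants.\<close>
    also have "\<dots> \<le> K * nnorm (L1 \<nu>) (ae_class \<nu> u) + ruelle_radius p f * nnorm (L1 \<nu>) (ae_class \<nu> u)"
      using order_trans[OF ind_functional_bound[OF A\<nu> T_in[OF u]] K[OF u]]
        ind_functional_bound[OF A' u] ruelle_radius_pos
      by (intro add_mono) (auto simp: abs_mult)
    finally show "\<bar>\<Lambda> u\<bar> \<le> (K + ruelle_radius p f) * (\<integral>x. \<bar>u x\<bar> \<partial>\<nu>)"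
      by (simp add: n distrib_right)
  next
    fix g :: "(nat \<Rightarrow> 'e) \<Rightarrow> real" assume "continuous_on UNIV g"
    then obtain \<phi> where \<phi>: "apply_bcontfun \<phi> = g"
      using continuous_obtain_bcontfun[OF compact_UNIV_seq[OF E]] by blast
    have "T (ae_class \<nu> g) = ae_class \<nu> (apply_bcontfun (ruelle p f \<phi>))"
      using T by (simp add: L1_extension_def flip: \<phi>)
    then show "\<Lambda> g = 0"
      using ruelle_shift_integral_indicator[OF A, of \<phi>] A' integrable_bcontfun[of \<phi>]
      by (simp add: \<Lambda>_def ind_functional_apply integrable_bcontfun \<phi> indicator_vimage)
  qed
  \<comment> \<open>On the carrier the equality is the vanishing of \<Lambda> at a representative;
    off it both sides are \<open>undefined\<close>. Membership in the dual opens the outer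
    restriction of \<open>ntranspose\<close>.\<close>
  show ?thesis
  proof
    fix U
    show "ntranspose (L1 \<nu>) T (ind_functional \<nu> A) U
      = nscale (ndual (L1 \<nu>)) (ruelle_radius p f) (ind_functional \<nu> (seq_shift -` A)) U"
    proof (cases "U \<in> ncarrier (L1 \<nu>)")
      case True
      then obtain g where "integrable \<nu> g" "U = ae_class \<nu> g" by (rule ncarrier_L1E)
      then show ?thesis
        using True \<Lambda>[of g] ind_functional_in_ndual[OF A\<nu>]
        by (simp add: ntranspose_def \<Lambda>_def) (simp add: ndual_def)
    next
      case False
      then show ?thesis
        using ind_functional_in_ndual[OF A\<nu>] by (simp add: ntranspose_def) (simp add: ndual_def)
    qed
  qed
qed

text \<open>The iterates of the positive operator \<open>T\<close> on the class of 1 stay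
  nonnegative, hence so do their integrals over \<open>A\<close>; dividing by a power of the
  positive eigenvalue keeps the sign.\<close>

lemma xi_seq_ind_functional_nonneg:
  assumes T: "L1_extension p f \<nu> T" and A: "A \<in> sets borel"
  shows "0 \<le> xi_seq p f \<nu> T n (ind_functional \<nu> A)"
proof -
  have A\<nu>: "A \<in> sets \<nu>" using A sets_\<nu> by simp
  define U where "U n = (T ^^ n) (ae_class \<nu> (\<lambda>x. 1))" for n
  \<comment> \<open>Carrier membership is carried along because positivity of \<open>T\<close> is
    stated for carrier elements only.\<close>
  have U: "U n \<in> ncarrier (L1 \<nu>) \<and> L1_nonneg \<nu> (U n)"
  proof (induction n)
    case 0
    have "AE x in \<nu>. 0 \<le> class_rep (ae_class \<nu> (\<lambda>x. 1)) x"
      using class_rep_ae_class(2)[of \<nu> "\<lambda>x. 1"] by auto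
    then show ?case by (simp add: U_def L1_nonneg_def ncarrier_L1I)
  next
    case (Suc n)
    then show ?case
      using T by (auto simp: U_def L1_extension_def nbounded_linear_def L1_positive_op_def)
  qed
  have "AE x in \<nu>. 0 \<le> indicator A x * class_rep (U n) x"
    using U unfolding L1_nonneg_def by auto
  then have "0 \<le> ind_functional \<nu> A (U n)"
    using U by (simp add: ind_functional_def integral_nonneg_AE)
  then show ?thesis
    using ind_functional_in_ndual[OF A\<nu>] ruelle_radius_pos
    \<comment> \<open>Instantiating \<open>ndual_def\<close> unfolds only the outer dual, so that
      membership in the inner one still matches the known fact.\<close>
    by (simp add: xi_seq_def ndual_def[of "ndual _"] ncanonical_def U_def)
qed

end

section \<open>Passage to the weak-star limit\<close>

theorem theorem4p1:
  fixes p :: "'e::metric_space measure"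
    and f :: "(nat \<Rightarrow> 'e) \<Rightarrow> real"
    and \<nu> :: "(nat \<Rightarrow> 'e) measure"
    and T :: "((nat \<Rightarrow> 'e) \<Rightarrow> real) set \<Rightarrow> ((nat \<Rightarrow> 'e) \<Rightarrow> real) set"
    and \<xi>f :: "(((nat \<Rightarrow> 'e) \<Rightarrow> real) set \<Rightarrow> real) \<Rightarrow> real"
    and D :: "'d set" and le :: "'d \<Rightarrow> 'd \<Rightarrow> bool" and h :: "'d \<Rightarrow> nat"
    and \<mu> :: "(nat \<Rightarrow> 'e) set \<Rightarrow> real"
  assumes "compact (UNIV :: 'e set)"
    and "p \<in> borel_probs" and "measure_support p = UNIV"
    and "continuous_on UNIV f"
    and "\<nu> \<in> Gstar p f"
    and "L1_extension p f \<nu> T"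
    and "neigenvector (ndual (ndual (L1 \<nu>)))
           (ntranspose (ndual (L1 \<nu>)) (ntranspose (L1 \<nu>) T)) (ruelle_radius p f) \<xi>f"
    and "subnet_index D le h"
    and "limitin (weak_star_topology (ndual (L1 \<nu>)))
           (\<lambda>d. xi_seq p f \<nu> T (h d)) \<xi>f (net_filter D le)"
    and "\<And>A. A \<in> sets borel \<Longrightarrow> \<mu> A = \<xi>f (ind_functional \<nu> A)"
  shows "(\<forall>A\<in>sets borel. 0 \<le> \<mu> A) \<and>
    Measure_Space.additive (sets borel) \<mu> \<and>
    (\<forall>A\<in>sets borel. \<mu> (seq_shift -` A) = \<mu> A)"
proof -
  note ctx = assms(1,2,4,5)
  note T = assms(6) and \<mu> = assms(10)
  let ?V = "L1 \<nu>" and ?\<rho> = "ruelle_radius p f"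
  have s: "sets \<nu> = sets borel" by (rule sets_\<nu>[OF ctx])
  have ind: "ind_functional \<nu> A \<in> ncarrier (ndual ?V)" if "A \<in> sets borel" for A
    using that by (intro ind_functional_in_ndual) (simp add: s)
  have \<xi>: "\<xi>f \<in> ncarrier (ndual (ndual ?V))"
    and eigen: "ntranspose (ndual ?V) (ntranspose ?V T) \<xi>f = nscale (ndual (ndual ?V)) ?\<rho> \<xi>f"
    using assms(7) by (auto simp: neigenvector_def)
  have \<xi>_add: "\<xi>f (nadd (ndual ?V) l m) = \<xi>f l + \<xi>f m"
    if "l \<in> ncarrier (ndual ?V)" "m \<in> ncarrier (ndual ?V)" for l m
    using \<xi> that unfolding ndual_def[of "ndual _"] by auto
  have \<xi>_scale: "\<xi>f (nscale (ndual ?V) c l) = c * \<xi>f l" if "l \<in> ncarrier (ndual ?V)" for l c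
    using \<xi> that unfolding ndual_def[of "ndual _"] by auto
  have dir: "directed_on D le" using assms(8) by (simp add: subnet_index_def)
  \<comment> \<open>Lower bounds survive limits only along a proper filter. Every tail contains its
    own starting index by reflexivity, so no tail is empty.\<close>
  have nontriv: "net_filter D le \<noteq> bot"
  proof
    assume "net_filter D le = bot"
    then have "eventually (\<lambda>_. False) (net_filter D le)" by simp
    then show False
      using dir unfolding eventually_net_filter[OF dir] directed_on_def by blast
  qed
  have "0 \<le> \<mu> A" if A: "A \<in> sets borel" for A
  proof -
    \<comment> \<open>Weak-star convergence is read off at the single coordinate given by the
      indicator functional of \<open>A\<close>.\<close>
    have "((\<lambda>d. xi_seq p f \<nu> T (h d) (ind_functional \<nu> A)) \<longlongrightarrow> \<xi>f (ind_functional \<nu> A))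
        (net_filter D le)"
      using assms(9) ind[OF A]
      by (simp add: weak_star_topology_def limitin_subtopology limitin_componentwise)
    then have "0 \<le> \<xi>f (ind_functional \<nu> A)"
      by (rule tendsto_lowerbound)
        (use nontriv xi_seq_ind_functional_nonneg[OF ctx T A] in auto)
    then show ?thesis using \<mu>[OF A] by simp
  qed
  moreover have "Measure_Space.additive (sets borel) \<mu>"
    unfolding Measure_Space.additive_def
    using \<mu> ind s by (auto simp: ind_functional_Un \<xi>_add)
  moreover have "\<mu> (seq_shift -` A) = \<mu> A" if A: "A \<in> sets borel" for A
  proof -
    have A': "seq_shift -` A \<in> sets borel"
      using measurable_sets[OF borel_measurable_seq_shift A] by simp
    \<comment> \<open>The eigenvector equation is evaluated at the indicator functional of
      \<open>A\<close>; the double transpose moves \<open>T\<close> onto that functional, where its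
      transpose produces the same eigenvalue and the preimage of \<open>A\<close>.\<close>
    have "?\<rho> * \<xi>f (ind_functional \<nu> A) = nscale (ndual (ndual ?V)) ?\<rho> \<xi>f (ind_functional \<nu> A)"
      using ind[OF A] by (simp add: ndual_def[of "ndual _"])
    also have "\<dots> = \<xi>f (ntranspose ?V T (ind_functional \<nu> A))"
      unfolding eigen[symmetric] using \<xi> ind[OF A] by (simp add: ntranspose_def[of "ndual _"])
    also have "\<dots> = ?\<rho> * \<xi>f (ind_functional \<nu> (seq_shift -` A))"
      using \<xi>_scale ind[OF A'] by (simp add: ntranspose_ind_functional[OF ctx T A])
    finally show ?thesis
      using ruelle_radius_pos[OF ctx] \<mu>[OF A] \<mu>[OF A'] by simp
  qed
  ultimately show ?thesis by blast
qed

end
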